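(* Let $\Gamma_1$ and $\Gamma_2$ be finite groups. Then there exist a graph $G$ and an edge $e \in E(G)$ such that $\operatorname{Aut}(G) \cong \Gamma_1$ and $\operatorname{Aut}(G-e) \cong \Gamma_2$.
   Context: All graphs are finite, simple, and undirected, and all groups are finite. $\operatorname{Aut}(G)$ denotes the automorphism group of a graph $G$, and $G-e$ denotes the graph obtained from $G$ by deleting the edge $e$ (keeping all vertices). *)

theory Defs
  imports "HOL-Algebra.Bij" "Graph_Theory.Pair_Digraph"
begin

text \<open>
  A finite simple undirected graph is a \<^locale>\<open>pair_graph\<close>: a finite vertex set
  \<^const>\<open>pverts\<close> and a symmetric irreflexive adjacency relation \<^const>\<open>parcs\<close> on it.
  The undirected edge \<open>uv\<close> is represented by the two arcs \<open>(u, v)\<close> and \<open>(v, u)\<close>, so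
  deleting it removes both.
\<close>

definition delete_edge :: "'a pair_pre_digraph \<Rightarrow> 'a \<Rightarrow> 'a \<Rightarrow> 'a pair_pre_digraph" where
  "delete_edge G u v = \<lparr>pverts = pverts G, parcs = parcs G - {(u, v), (v, u)}\<rparr>"

definition automorphisms :: "'a pair_pre_digraph \<Rightarrow> ('a \<Rightarrow> 'a) set" where
  "automorphisms G = {f \<in> Bij (pverts G).
     \<forall>u \<in> pverts G. \<forall>v \<in> pverts G. (u, v) \<in> parcs G \<longleftrightarrow> (f u, f v) \<in> parcs G}"

definition Aut :: "'a pair_pre_digraph \<Rightarrow> ('a \<Rightarrow> 'a) monoid" where
  "Aut G = (BijGroup (pverts G))\<lparr>carrier := automorphisms G\<rparr>"

lemma pair_graph_delete_edge:
  assumes "pair_graph G"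
  shows "pair_graph (delete_edge G u v)"
proof -
  interpret pair_graph G by fact
  show ?thesis
    using arc_fst_in_verts arc_snd_in_verts pair_finite_verts pair_finite_arcs
      pair_sym_arcs pair_no_loops
    by unfold_locales (auto simp: delete_edge_def symmetric_def sym_def)
qed

lemma subgroup_automorphisms: "subgroup (automorphisms G) (BijGroup (pverts G))"
proof (rule group.subgroupI[OF group_BijGroup])
  show "automorphisms G \<subseteq> carrier (BijGroup (pverts G))"
    by (auto simp: automorphisms_def BijGroup_def)
  have "(\<lambda>x \<in> pverts G. x) \<in> automorphisms G"
    by (auto simp: automorphisms_def id_Bij)
  then show "automorphisms G \<noteq> {}" by blast
next
  fix f assume f: "f \<in> automorphisms G"
  then have fB: "f \<in> Bij (pverts G)" by (simp add: automorphisms_def)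
  let ?g = "\<lambda>x \<in> pverts G. inv_into (pverts G) f x"
  have g: "?g x \<in> pverts G" "f (?g x) = x" if "x \<in> pverts G" for x
    using fB that by (auto simp: Bij_def bij_betw_def inv_into_into f_inv_into_f)
  have "?g \<in> Bij (pverts G)" using fB by (rule restrict_inv_into_Bij)
  moreover have "(u, v) \<in> parcs G \<longleftrightarrow> (?g u, ?g v) \<in> parcs G"
    if "u \<in> pverts G" "v \<in> pverts G" for u v
  proof -
    have "(?g u, ?g v) \<in> parcs G \<longleftrightarrow> (f (?g u), f (?g v)) \<in> parcs G"
      using f g(1)[OF that(1)] g(1)[OF that(2)] unfolding automorphisms_def by blast
    then show ?thesis using g(2) that by simp
  qed
  ultimately have "?g \<in> automorphisms G" unfolding automorphisms_def by blast
  then show "inv\<^bsub>BijGroup (pverts G)\<^esub> f \<in> automorphisms G"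
    using fB by (simp add: inv_BijGroup)
next
  fix f g assume fg: "f \<in> automorphisms G" "g \<in> automorphisms G"
  then have B: "f \<in> Bij (pverts G)" "g \<in> Bij (pverts G)"
    by (simp_all add: automorphisms_def)
  have gV: "g u \<in> pverts G" if "u \<in> pverts G" for u
    using B(2) that by (auto simp: Bij_def bij_betw_def)
  have "compose (pverts G) f g \<in> automorphisms G"
    using fg gV B by (simp add: automorphisms_def compose_Bij compose_eq)
  then show "f \<otimes>\<^bsub>BijGroup (pverts G)\<^esub> g \<in> automorphisms G"
    using B by (simp add: BijGroup_def)
qed

lemma group_Aut: "group (Aut G)"
  unfolding Aut_def by (rule group.subgroup_imp_group[OF group_BijGroup subgroup_automorphisms])

end

theory Submission
  imports Defs
begin

text \<open>
  Suppose that \<open>\<Gamma>\<close> and \<open>\<Delta>\<close> act regularly on marked vertices of two connected graphs whose full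
  automorphism groups they are. Take one copy of the first graph and, for every \<open>g \<in> \<Gamma>\<close>, a copy
  of the second one, joined to the first by a single edge from the vertex \<open>g\<close> to the
  vertex \<open>\<one>\<close> of the copy. Provided that automorphisms cannot mix the two kinds of vertices, every copy of the second graph is pinned at \<open>\<one>\<close> and
  hence rigid, so the automorphisms of the whole are those of the first graph, which carry the copies
  along: the group is \<open>\<Gamma>\<close>. Now delete the edge at \<open>\<one> \<in> \<Gamma>\<close>. The vertex \<open>\<one>\<close> of the first graph
  has become the only one without a copy, so the first graph can no longer move, and neither can
  the copies that are still attached; but the detached copy has lost its pin and regains all
  symmetries of the second graph: the group is \<open>\<Delta>\<close>.

  It is easiest to carry this out with coloured vertices, which also keeps the kinds apart. The marked vertices of
  \<open>\<Gamma>\<close> are then the nodes of its Cayley digraph, and the arrow of the generator \<open>s\<close> starting at \<open>g\<close> is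
  replaced by an additional vertex of colour \<open>s\<close>. The lemma \<open>cayley_rigid\<close> shows that the
  colour-preserving automorphisms are the left translations; \<open>exact_action_all_links\<close> and
  \<open>exact_action_one_link_missing\<close> are the two halves of the argument above.

  Colours are then traded for adjacency to the vertices of a large clique, the anchors: a vertex of
  colour \<open>k\<close> is joined to all anchors \<open>i \<ge> k\<close>. The anchors have pairwise distinct degrees, all larger
  than the other degrees, hence are fixed by every automorphism, and colours can be read off from
  them (\<open>exact_action_anchored\<close>). The anchors do not touch the edges between coloured vertices, so
  deleting such an edge commutes with the construction.
\<close>

section \<open>Exact actions\<close>

text \<open>
  Both groups have to be followed through a change of graph. Instead of composing group isomorphisms,
  the locale records an explicit faithful action of \<open>\<Gamma>\<close> by colour-preserving automorphisms that
  exhausts all of them; each change of graph then only has to transport the action. A plain graph is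
  a graph with one colour.
\<close>

locale exact_action =
  fixes \<Gamma> :: "('a, 'm) monoid_scheme" (structure)
    and X :: "'v pair_pre_digraph" and c :: "'v \<Rightarrow> 'k" and \<phi> :: "'a \<Rightarrow> 'v \<Rightarrow> 'v"
  assumes group: "group \<Gamma>"
    and maps: "\<lbrakk>a \<in> carrier \<Gamma>; x \<in> pverts X\<rbrakk> \<Longrightarrow> \<phi> a x \<in> pverts X"
    and colour: "\<lbrakk>a \<in> carrier \<Gamma>; x \<in> pverts X\<rbrakk> \<Longrightarrow> c (\<phi> a x) = c x"
    and arcs: "\<lbrakk>a \<in> carrier \<Gamma>; x \<in> pverts X; y \<in> pverts X; (x, y) \<in> parcs X\<rbrakk>
      \<Longrightarrow> (\<phi> a x, \<phi> a y) \<in> parcs X"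
    and mult: "\<lbrakk>a \<in> carrier \<Gamma>; b \<in> carrier \<Gamma>; x \<in> pverts X\<rbrakk> \<Longrightarrow> \<phi> (a \<otimes> b) x = \<phi> a (\<phi> b x)"
    and one: "x \<in> pverts X \<Longrightarrow> \<phi> \<one> x = x"
    and faithful: "\<lbrakk>a \<in> carrier \<Gamma>; \<And>x. x \<in> pverts X \<Longrightarrow> \<phi> a x = x\<rbrakk> \<Longrightarrow> a = \<one>"
    and complete: "\<lbrakk>bij_betw f (pverts X) (pverts X); \<And>x. x \<in> pverts X \<Longrightarrow> c (f x) = c x;
      \<And>x y. \<lbrakk>x \<in> pverts X; y \<in> pverts X\<rbrakk> \<Longrightarrow> (x, y) \<in> parcs X \<longleftrightarrow> (f x, f y) \<in> parcs X\<rbrakk>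
      \<Longrightarrow> \<exists>a \<in> carrier \<Gamma>. \<forall>x \<in> pverts X. f x = \<phi> a x"
begin

lemma inv_cancel:
  assumes "a \<in> carrier \<Gamma>" "x \<in> pverts X"
  shows "\<phi> (inv a) (\<phi> a x) = x" and "\<phi> a (\<phi> (inv a) x) = x"
  using assms group mult[of "inv a" a x] mult[of a "inv a" x] one
  by (simp_all add: group.inv_closed group.l_inv group.r_inv)

lemma bij: "a \<in> carrier \<Gamma> \<Longrightarrow> bij_betw (\<phi> a) (pverts X) (pverts X)"
  by (rule bij_betw_byWitness[where f' = "\<phi> (inv a)"])
    (auto simp: inv_cancel maps group group.inv_closed)

lemma arcs_iff:
  assumes "a \<in> carrier \<Gamma>" "x \<in> pverts X" "y \<in> pverts X"
  shows "(x, y) \<in> parcs X \<longleftrightarrow> (\<phi> a x, \<phi> a y) \<in> parcs X"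
  using arcs[OF assms] arcs[of "inv a" "\<phi> a x" "\<phi> a y"] assms group
  by (auto simp: inv_cancel maps group.inv_closed)

lemma recolour:
  assumes "inj_on k (c ` pverts X)"
  shows "exact_action \<Gamma> X (k \<circ> c) \<phi>"
proof (rule exact_action.intro, goal_cases)
  case (8 f)
  have "c (f x) = c x" if "x \<in> pverts X" for x
    using 8(2)[OF that] that bij_betwE[OF 8(1)] by (auto intro: inj_onD[OF assms])
  then show ?case using complete 8 by blast
qed (auto simp: group maps colour arcs mult one faithful)

lemma Aut_iso:
  assumes mono: "\<And>x y. c x = c y"
  shows "Aut X \<cong> \<Gamma>"
proof -
  define h where "h = (\<lambda>a. restrict (\<phi> a) (pverts X))"
  have h: "h a \<in> automorphisms X" if "a \<in> carrier \<Gamma>" for a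
    using that bij arcs_iff by (auto simp: h_def automorphisms_def Bij_def)
  have h_mult: "h (a \<otimes> b) = h a \<otimes>\<^bsub>Aut X\<^esub> h b" if "a \<in> carrier \<Gamma>" "b \<in> carrier \<Gamma>" for a b
  proof -
    have "h a \<in> Bij (pverts X)" "h b \<in> Bij (pverts X)" using h that by (simp_all add: automorphisms_def)
    then have "h a \<otimes>\<^bsub>Aut X\<^esub> h b = compose (pverts X) (h a) (h b)"
      by (simp add: Aut_def BijGroup_def)
    also have "\<dots> = h (a \<otimes> b)"
      using that by (intro ext) (simp add: h_def compose_def maps mult)
    finally show ?thesis by simp
  qed
  have hom: "h \<in> hom \<Gamma> (Aut X)"
    using h h_mult by (auto simp: hom_def Aut_def)
  have inj: "inj_on h (carrier \<Gamma>)"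
  proof (rule inj_onI)
    interpret group \<Gamma> by (rule group)
    fix a b assume ab: "a \<in> carrier \<Gamma>" "b \<in> carrier \<Gamma>" "h a = h b"
    have "inv b \<otimes> a = \<one>"
    proof (rule faithful)
      fix x assume x: "x \<in> pverts X"
      then have "\<phi> a x = \<phi> b x" using fun_cong[OF ab(3), of x] by (simp add: h_def)
      then show "\<phi> (inv b \<otimes> a) x = x" using ab x by (simp add: mult inv_cancel)
    qed (use ab in simp)
    then have "inv (inv b) = a" using ab by (intro inv_equality) (simp_all add: inv_comm)
    then show "a = b" using ab by simp
  qed
  have "f \<in> h ` carrier \<Gamma>" if f: "f \<in> automorphisms X" for f
  proof -
    have "\<exists>a \<in> carrier \<Gamma>. \<forall>x \<in> pverts X. f x = \<phi> a x"
      using f by (intro complete) (auto simp: automorphisms_def Bij_def mono)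
    then obtain a where a: "a \<in> carrier \<Gamma>" "\<And>x. x \<in> pverts X \<Longrightarrow> f x = \<phi> a x" by blast
    have "f \<in> extensional (pverts X)" using f by (auto simp: automorphisms_def Bij_def)
    then have "f = h a" unfolding h_def using a(2) by (intro extensionalityI[of f "pverts X"]) simp_all
    with a(1) show ?thesis by blast
  qed
  with h have "h ` carrier \<Gamma> = carrier (Aut X)" by (auto simp: Aut_def)
  with hom inj have "h \<in> iso \<Gamma> (Aut X)" by (auto simp: iso_def bij_betw_def)
  then show ?thesis using group group.iso_sym is_isoI by blast
qed

end

section \<open>Relabelling the vertices of a graph\<close>

lemma pair_graphI:
  assumes "finite (pverts G)" "parcs G \<subseteq> pverts G \<times> pverts G" "sym (parcs G)" "irrefl (parcs G)"
  shows "pair_graph G"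
proof -
  have "finite (parcs G)" using assms(1,2) by (meson finite_SigmaI finite_subset)
  then show ?thesis
    using assms by unfold_locales (auto simp: symmetric_def irrefl_def)
qed

lemma pair_graph_props:
  assumes "pair_graph G"
  shows "finite (pverts G)" "parcs G \<subseteq> pverts G \<times> pverts G" "sym (parcs G)" "irrefl (parcs G)"
proof -
  interpret pair_graph G by fact
  show "finite (pverts G)" "parcs G \<subseteq> pverts G \<times> pverts G" "sym (parcs G)" "irrefl (parcs G)"
    using pair_no_loops in_arcsD1 in_arcsD2 pair_sym_arcs by (fastforce simp: symmetric_def irrefl_def)+
qed

definition relabel :: "('v \<Rightarrow> 'w) \<Rightarrow> 'v pair_pre_digraph \<Rightarrow> 'w pair_pre_digraph" where
  "relabel h G = \<lparr>pverts = h ` pverts G, parcs = map_prod h h ` parcs G\<rparr>"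

lemma relabel_arc:
  assumes "pair_graph G" "inj_on h (pverts G)" "x \<in> pverts G" "y \<in> pverts G"
  shows "(h x, h y) \<in> parcs (relabel h G) \<longleftrightarrow> (x, y) \<in> parcs G"
proof
  assume "(h x, h y) \<in> parcs (relabel h G)"
  then obtain x' y' where "(x', y') \<in> parcs G" "h x = h x'" "h y = h y'"
    by (auto simp: relabel_def)
  moreover from this have "x' \<in> pverts G" "y' \<in> pverts G" using pair_graph_props(2)[OF assms(1)] by auto
  ultimately show "(x, y) \<in> parcs G" using assms by (metis inj_onD)
qed (auto simp: relabel_def)

lemma pair_graph_relabel:
  assumes "pair_graph G" "inj_on h (pverts G)"
  shows "pair_graph (relabel h G)"
proof (rule pair_graphI)
  note G = pair_graph_props[OF assms(1)]
  show "finite (pverts (relabel h G))" "parcs (relabel h G) \<subseteq> pverts (relabel h G) \<times> pverts (relabel h G)"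
    using G by (auto simp: relabel_def)
  show "sym (parcs (relabel h G))"
  proof (rule symI)
    fix p q assume "(p, q) \<in> parcs (relabel h G)"
    then obtain x y where "p = h x" "q = h y" "(x, y) \<in> parcs G" by (auto simp: relabel_def)
    then show "(q, p) \<in> parcs (relabel h G)" using symD[OF G(3)] by (auto simp: relabel_def)
  qed
  show "irrefl (parcs (relabel h G))"
    using G(2,4) assms(2) by (auto simp: relabel_def irrefl_def dest!: inj_onD)
qed

lemma delete_edge_relabel:
  assumes "pair_graph G" "inj_on h (pverts G)" "u \<in> pverts G" "v \<in> pverts G"
  shows "delete_edge (relabel h G) (h u) (h v) = relabel h (delete_edge G u v)"
proof -
  have "map_prod h h ` parcs G - {(h u, h v), (h v, h u)} = map_prod h h ` (parcs G - {(u, v), (v, u)})"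
    using pair_graph_props(2)[OF assms(1)] assms(2-4) by (auto dest: inj_onD)
  then show ?thesis by (simp add: delete_edge_def relabel_def)
qed

lemma exact_action_relabel:
  fixes \<Gamma> :: "('a, 'm) monoid_scheme"
  assumes "pair_graph G" and h: "inj_on h (pverts G)" and "exact_action \<Gamma> G (\<lambda>_. ()) \<phi>"
  shows "exact_action \<Gamma> (relabel h G) (\<lambda>_. ()) (\<lambda>a y. h (\<phi> a (the_inv_into (pverts G) h y)))"
proof -
  interpret exact_action \<Gamma> G "\<lambda>_. ()" \<phi> by fact
  let ?V = "pverts G" and ?j = "the_inv_into (pverts G) h"
  have j: "?j (h x) = x" if "x \<in> ?V" for x using the_inv_into_f_f[OF h that] .
  have V: "pverts (relabel h G) = h ` ?V" by (simp add: relabel_def)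
  show ?thesis
  proof (rule exact_action.intro, goal_cases)
    case (4 a x y)
    then show ?case using maps arcs by (auto simp: V j relabel_arc[OF assms(1) h])
  next
    case (7 a)
    show ?case
    proof (rule faithful[OF 7(1)])
      fix x assume x: "x \<in> ?V"
      then have "h (\<phi> a x) = h x" using 7(2)[of "h x"] by (simp add: V j)
      then show "\<phi> a x = x" using h x maps[OF 7(1) x] by (auto dest: inj_onD)
    qed
  next
    case (8 f)
    let ?f = "\<lambda>x. ?j (f (h x))"
    have hV: "bij_betw h ?V (h ` ?V)" using h by (simp add: bij_betw_def)
    have "bij_betw (?j \<circ> (f \<circ> h)) ?V ?V"
      using hV 8(1) bij_betw_the_inv_into[OF hV] by (intro bij_betw_trans) (simp_all add: V)
    then have bij: "bij_betw ?f ?V ?V" by (simp add: comp_def)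
    have hf: "h (?f x) = f (h x)" "?f x \<in> ?V" if "x \<in> ?V" for x
    proof -
      have "f (h x) \<in> h ` ?V" using that 8(1) by (auto simp: V bij_betw_def)
      then show "h (?f x) = f (h x)" using f_the_inv_into_f[OF h] by blast
      show "?f x \<in> ?V" using bij that by (auto simp: bij_betw_def)
    qed
    have "\<exists>a \<in> carrier \<Gamma>. \<forall>x \<in> ?V. ?f x = \<phi> a x"
    proof (rule complete[OF bij])
      fix x y assume xy: "x \<in> ?V" "y \<in> ?V"
      have "(x, y) \<in> parcs G \<longleftrightarrow> (f (h x), f (h y)) \<in> parcs (relabel h G)"
        using 8(3)[of "h x" "h y"] xy by (simp add: V relabel_arc[OF assms(1) h])
      also have "\<dots> \<longleftrightarrow> (?f x, ?f y) \<in> parcs G"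
        using relabel_arc[OF assms(1) h, of "?f x" "?f y"] hf xy by simp
      finally show "(x, y) \<in> parcs G \<longleftrightarrow> (?f x, ?f y) \<in> parcs G" .
    qed simp
    then obtain a where a: "a \<in> carrier \<Gamma>" "\<And>x. x \<in> ?V \<Longrightarrow> ?f x = \<phi> a x" by blast
    have "f y = h (\<phi> a (?j y))" if "y \<in> h ` ?V" for y
      using that hf a(2) by (auto simp: j)
    then show ?case using a(1) V by auto
  qed (auto simp: V j group maps mult one)
qed

section \<open>Replacing colours by anchors\<close>

text \<open>
  Besides the anchors, every original vertex receives a leaf. Leaves are joined to all anchors: they
  behave as a colour class 0 as large as the vertex set of the given graph, which lifts the degree of every anchor above the degrees
  of all other vertices, while a leaf costs its owner only one additional neighbour.
\<close>

datatype 'v anchored = Orig 'v | Leaf 'v | Anchor nat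

fun joined :: "'v pair_pre_digraph \<Rightarrow> ('v \<Rightarrow> nat) \<Rightarrow> 'v anchored \<Rightarrow> 'v anchored \<Rightarrow> bool" where
  "joined X c (Orig x) (Orig y) \<longleftrightarrow> (x, y) \<in> parcs X"
| "joined X c (Orig x) (Leaf y) \<longleftrightarrow> x = y"
| "joined X c (Leaf x) (Orig y) \<longleftrightarrow> x = y"
| "joined X c (Leaf x) (Leaf y) \<longleftrightarrow> False"
| "joined X c (Orig x) (Anchor i) \<longleftrightarrow> c x \<le> i"
| "joined X c (Anchor i) (Orig x) \<longleftrightarrow> c x \<le> i"
| "joined X c (Leaf x) (Anchor i) \<longleftrightarrow> True"
| "joined X c (Anchor i) (Leaf x) \<longleftrightarrow> True"
| "joined X c (Anchor i) (Anchor j) \<longleftrightarrow> i \<noteq> j"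

definition anchored :: "'v pair_pre_digraph \<Rightarrow> ('v \<Rightarrow> nat) \<Rightarrow> nat \<Rightarrow> 'v anchored pair_pre_digraph" where
  "anchored X c N = (let W = Orig ` pverts X \<union> Leaf ` pverts X \<union> Anchor ` {..<N}
     in \<lparr>pverts = W, parcs = {(p, q) \<in> W \<times> W. joined X c p q}\<rparr>)"

lemma pverts_anchored: "pverts (anchored X c N) = Orig ` pverts X \<union> Leaf ` pverts X \<union> Anchor ` {..<N}"
  by (simp add: anchored_def Let_def)

lemma parcs_anchored:
  "(p, q) \<in> parcs (anchored X c N) \<longleftrightarrow>
    p \<in> pverts (anchored X c N) \<and> q \<in> pverts (anchored X c N) \<and> joined X c p q"
  by (auto simp: anchored_def Let_def)

lemma pair_graph_anchored:
  assumes "pair_graph X"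
  shows "pair_graph (anchored X c N)"
proof (rule pair_graphI)
  note X = pair_graph_props[OF assms]
  have s: "joined X c q p" if "joined X c p q" for p q
    using that X(3) by (cases "(X, c, p, q)" rule: joined.cases) (auto simp: sym_def)
  have i: "\<not> joined X c p p" for p
    using X(4) by (cases p) (auto simp: irrefl_def)
  show "finite (pverts (anchored X c N))" using X by (simp add: pverts_anchored)
  show "parcs (anchored X c N) \<subseteq> pverts (anchored X c N) \<times> pverts (anchored X c N)"
    by (auto simp: parcs_anchored)
  show "sym (parcs (anchored X c N))" using s by (auto simp: sym_def parcs_anchored)
  show "irrefl (parcs (anchored X c N))" using i by (auto simp: irrefl_def parcs_anchored)
qed

lemma delete_edge_anchored:
  "delete_edge (anchored X c N) (Orig u) (Orig v) = anchored (delete_edge X u v) c N"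
proof -
  have "joined (delete_edge X u v) c p q \<longleftrightarrow>
      joined X c p q \<and> (p, q) \<notin> {(Orig u, Orig v), (Orig v, Orig u)}" for p q
    by (cases "(X, c, p, q)" rule: joined.cases) (auto simp: delete_edge_def)
  then show ?thesis by (auto simp: anchored_def delete_edge_def Let_def)
qed

text \<open>
  All colours between 1 and \<open>N - 1\<close> occur, so the number of vertices below an anchor grows strictly
  with its index. Non-universality bounds the degrees in \<open>X\<close> by \<open>card (pverts X) - 2\<close>, just enough
  to stay below the smallest degree of an anchor, which is \<open>card (pverts X) + N - 1\<close>; for the leaves,
  of degree \<open>N + 1\<close>, three vertices suffice.
\<close>

locale anchoring =
  fixes X :: "'v pair_pre_digraph" and c :: "'v \<Rightarrow> nat" and N :: nat
  assumes graph: "pair_graph X"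
    and colours: "c ` pverts X = {1..<N}"
    and large: "card (pverts X) \<ge> 3"
    and non_universal: "x \<in> pverts X \<Longrightarrow> \<exists>y \<in> pverts X. y \<noteq> x \<and> (x, y) \<notin> parcs X"
begin

lemma finite_X: "finite (pverts X)" and irrefl_X: "irrefl (parcs X)"
  using pair_graph_props[OF graph] by auto

lemma colour_bounds:
  assumes "x \<in> pverts X"
  shows "1 \<le> c x" "c x < N"
proof -
  have "c x \<in> {1..<N}" using assms colours by blast
  then show "1 \<le> c x" "c x < N" by auto
qed

lemma N_pos: "0 < N"
proof -
  have "pverts X \<noteq> {}" using large by auto
  then obtain x where "x \<in> pverts X" by blast
  then show ?thesis using colour_bounds[of x] by simp
qed

abbreviation "G \<equiv> anchored X c N"

definition deg :: "'v anchored \<Rightarrow> nat" where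
  "deg p = card {q. (p, q) \<in> parcs G}"

lemma deg_Orig:
  assumes x: "x \<in> pverts X"
  shows "deg (Orig x) < card (pverts X) + N - 1"
proof -
  obtain y where y: "y \<in> pverts X" "y \<noteq> x" "(x, y) \<notin> parcs X" using non_universal[OF x] by blast
  have "{q. (Orig x, q) \<in> parcs G} \<subseteq> Orig ` (pverts X - {x, y}) \<union> {Leaf x} \<union> Anchor ` {1..<N}"
    using x y irrefl_X colour_bounds[OF x] by (fastforce simp: parcs_anchored pverts_anchored irrefl_def)
  then have "deg (Orig x) \<le> card (Orig ` (pverts X - {x, y}) \<union> {Leaf x} \<union> Anchor ` {1..<N})"
    unfolding deg_def using finite_X by (intro card_mono) auto
  also have "\<dots> \<le> card (Orig ` (pverts X - {x, y})) + 1 + card (Anchor ` {1..<N} :: 'v anchored set)"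
    by (rule order_trans[OF card_Un_le] add_mono)+ (use card_Un_le in auto)
  also have "\<dots> = card (pverts X) - 2 + 1 + (N - 1)"
    using x y finite_X by (simp add: card_image inj_on_def card_Diff_subset)
  also have "\<dots> < card (pverts X) + N - 1" using large N_pos by simp
  finally show ?thesis .
qed

lemma deg_Leaf:
  assumes x: "x \<in> pverts X"
  shows "deg (Leaf x) < card (pverts X) + N - 1"
proof -
  have "{q. (Leaf x, q) \<in> parcs G} = insert (Orig x) (Anchor ` {..<N})"
    using x by (auto simp: parcs_anchored pverts_anchored)
  then have "deg (Leaf x) = N + 1"
    by (simp add: deg_def card_image inj_on_def image_iff)
  then show ?thesis using large by simp
qed

lemma deg_Anchor:
  assumes i: "i < N"
  shows "deg (Anchor i) = card (pverts X) + N - 1 + card {x \<in> pverts X. c x \<le> i}"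
proof -
  let ?C = "{x \<in> pverts X. c x \<le> i}"
  have "{q. (Anchor i, q) \<in> parcs G} = Leaf ` pverts X \<union> (Orig ` ?C \<union> Anchor ` ({..<N} - {i}))"
    using i by (auto simp: parcs_anchored pverts_anchored)
  also have "card \<dots> = card (pverts X) + (card ?C + (N - 1))"
    using i finite_X by (subst card_Un_disjoint card_image; (auto simp: inj_on_def)[1])+
  finally show ?thesis using i by (simp add: deg_def)
qed

lemma deg_Anchor_mono:
  assumes "i < j" "j < N"
  shows "deg (Anchor i) < deg (Anchor j)"
proof -
  have "j \<in> c ` pverts X" using assms by (auto simp: colours)
  then obtain x where "x \<in> pverts X" "c x = j" by blast
  then have "x \<in> {x \<in> pverts X. c x \<le> j} - {x \<in> pverts X. c x \<le> i}" using assms by simp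
  moreover have "{x \<in> pverts X. c x \<le> i} \<subseteq> {x \<in> pverts X. c x \<le> j}" using assms by auto
  ultimately have "{x \<in> pverts X. c x \<le> i} \<subset> {x \<in> pverts X. c x \<le> j}" by blast
  then have "card {x \<in> pverts X. c x \<le> i} < card {x \<in> pverts X. c x \<le> j}"
    using finite_X by (intro psubset_card_mono) auto
  then show ?thesis using assms by (simp add: deg_Anchor)
qed

lemma deg_automorphism:
  assumes F: "bij_betw F (pverts G) (pverts G)"
    and arcs: "\<And>p q. \<lbrakk>p \<in> pverts G; q \<in> pverts G\<rbrakk> \<Longrightarrow> (p, q) \<in> parcs G \<longleftrightarrow> (F p, F q) \<in> parcs G"
    and p: "p \<in> pverts G"
  shows "deg (F p) = deg p"
proof -
  have "{q. (F p, q) \<in> parcs G} = F ` {q. (p, q) \<in> parcs G}" (is "?L = ?R")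
  proof
    show "?L \<subseteq> ?R"
    proof
      fix q assume q: "q \<in> ?L"
      then have "q \<in> F ` pverts G" using F by (auto simp: parcs_anchored bij_betw_def)
      then obtain q' where "q' \<in> pverts G" "q = F q'" by blast
      with q arcs[OF p] show "q \<in> ?R" by auto
    qed
    show "?R \<subseteq> ?L" using arcs[OF p] by (auto simp: parcs_anchored)
  qed
  moreover have "inj_on F {q. (p, q) \<in> parcs G}"
    using F by (auto simp: bij_betw_def parcs_anchored intro: inj_on_subset)
  ultimately show ?thesis by (simp add: deg_def card_image)
qed

lemma Anchor_fixed:
  assumes F: "bij_betw F (pverts G) (pverts G)"
    and arcs: "\<And>p q. \<lbrakk>p \<in> pverts G; q \<in> pverts G\<rbrakk> \<Longrightarrow> (p, q) \<in> parcs G \<longleftrightarrow> (F p, F q) \<in> parcs G"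
    and i: "i < N"
  shows "F (Anchor i) = Anchor i"
proof -
  have p: "Anchor i \<in> pverts G" using i by (simp add: pverts_anchored)
  have d: "deg (F (Anchor i)) = deg (Anchor i)" using deg_automorphism[OF F arcs p] .
  have "F (Anchor i) \<in> pverts G" using F p by (auto simp: bij_betw_def)
  moreover have "deg (Anchor i) \<ge> card (pverts X) + N - 1" using i by (simp add: deg_Anchor)
  ultimately obtain j where j: "j < N" "F (Anchor i) = Anchor j"
    using d deg_Orig deg_Leaf by (fastforce simp: pverts_anchored)
  then show ?thesis using d i deg_Anchor_mono[of i j] deg_Anchor_mono[of j i]
    by (cases i j rule: linorder_cases) auto
qed

text \<open>
  Once the anchors are fixed, anchor 0 separates leaves from original vertices, as colours start at 1,
  and the least anchor joined to an original vertex is its colour.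
\<close>

lemma automorphism_descends:
  assumes F: "bij_betw F (pverts G) (pverts G)"
    and arcs: "\<And>p q. \<lbrakk>p \<in> pverts G; q \<in> pverts G\<rbrakk> \<Longrightarrow> (p, q) \<in> parcs G \<longleftrightarrow> (F p, F q) \<in> parcs G"
  obtains f where "bij_betw f (pverts X) (pverts X)" "\<And>x. x \<in> pverts X \<Longrightarrow> c (f x) = c x"
    "\<And>x y. \<lbrakk>x \<in> pverts X; y \<in> pverts X\<rbrakk> \<Longrightarrow> (x, y) \<in> parcs X \<longleftrightarrow> (f x, f y) \<in> parcs X"
    "\<And>x. x \<in> pverts X \<Longrightarrow> F (Orig x) = Orig (f x) \<and> F (Leaf x) = Leaf (f x)"
proof -
  have inj: "p = q" if "F p = F q" "p \<in> pverts G" "q \<in> pverts G" for p q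
    using F that by (auto simp: bij_betw_def dest: inj_onD)
  have FV: "F p \<in> pverts G" if "p \<in> pverts G" for p using F that by (auto simp: bij_betw_def)
  have not_Anchor: "F p \<notin> range Anchor" if p: "p \<in> pverts G" "p \<notin> range Anchor" for p
  proof
    assume "F p \<in> range Anchor"
    then obtain i where i: "F p = Anchor i" by blast
    with FV[OF p(1)] have "i < N" by (auto simp: pverts_anchored)
    then have "F p = F (Anchor i)" "Anchor i \<in> pverts G"
      using i Anchor_fixed[OF F arcs] by (simp_all add: pverts_anchored)
    then have "p = Anchor i" using inj p(1) by blast
    with p(2) show False by blast
  qed
  have adj: "joined X c (F p) (Anchor i) \<longleftrightarrow> joined X c p (Anchor i)"
    if "p \<in> pverts G" "i < N" for p i
    using arcs[of p "Anchor i"] that FV[OF that(1)] Anchor_fixed[OF F arcs that(2)]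
    by (simp add: parcs_anchored pverts_anchored)
  have "\<exists>y \<in> pverts X. F (Orig x) = Orig y" if x: "x \<in> pverts X" for x
  proof -
    have p: "Orig x \<in> pverts G" using x by (simp add: pverts_anchored)
    have "\<not> joined X c (F (Orig x)) (Anchor 0)"
      using adj[OF p N_pos] colour_bounds[OF x] by simp
    then show ?thesis using FV[OF p] not_Anchor[OF p] by (auto simp: pverts_anchored)
  qed
  then obtain f where f: "\<And>x. x \<in> pverts X \<Longrightarrow> f x \<in> pverts X \<and> F (Orig x) = Orig (f x)" by metis
  have O: "Orig x \<in> pverts G" "Leaf x \<in> pverts G" if "x \<in> pverts X" for x
    using that by (auto simp: pverts_anchored)
  have L: "F (Leaf x) = Leaf (f x)" if x: "x \<in> pverts X" for x
  proof -
    have "joined X c (F (Leaf x)) (Anchor 0)" using adj[OF O(2)[OF x] N_pos] by simp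
    then obtain y where y: "F (Leaf x) = Leaf y"
      using FV[OF O(2)[OF x]] not_Anchor[OF O(2)[OF x]] colour_bounds by (fastforce simp: pverts_anchored)
    have "(F (Orig x), F (Leaf x)) \<in> parcs G"
      using arcs[OF O[OF x]] O[OF x] by (simp add: parcs_anchored)
    then show ?thesis using y f[OF x] by (simp add: parcs_anchored)
  qed
  have "inj_on f (pverts X)"
    using f O inj by (intro inj_onI) (metis anchored.inject(1))
  then have bij: "bij_betw f (pverts X) (pverts X)"
    using f finite_X by (simp add: bij_betw_def endo_inj_surj image_subsetI)
  have col: "c (f x) = c x" if x: "x \<in> pverts X" for x
  proof -
    have "c (f x) \<le> i \<longleftrightarrow> c x \<le> i" if "i < N" for i
      using adj[OF O(1)[OF x] that] f[OF x] by simp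
    then show ?thesis
      using colour_bounds(2)[OF x] colour_bounds(2)[of "f x"] f[OF x] by (meson le_antisym order_refl)
  qed
  have "(x, y) \<in> parcs X \<longleftrightarrow> (f x, f y) \<in> parcs X" if "x \<in> pverts X" "y \<in> pverts X" for x y
    using arcs[OF O(1)[OF that(1)] O(1)[OF that(2)]] f that O by (simp add: parcs_anchored)
  with bij col f L show ?thesis using that by blast
qed

lemma exact_action_anchored:
  assumes "exact_action \<Gamma> X c \<phi>"
  shows "exact_action \<Gamma> G (\<lambda>_. ()) (\<lambda>a. map_anchored (\<phi> a))"
proof -
  interpret exact_action \<Gamma> X c \<phi> by fact
  show ?thesis
  proof (rule exact_action.intro, goal_cases)
    case (4 a p q)
    have "joined X c (map_anchored (\<phi> a) p) (map_anchored (\<phi> a) q)"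
      using 4 colour arcs by (cases "(X, c, p, q)" rule: joined.cases) (auto simp: parcs_anchored pverts_anchored)
    then show ?case using 4 maps by (auto simp: parcs_anchored pverts_anchored)
  next
    case (7 a)
    show ?case
    proof (rule faithful[OF 7(1)])
      fix x assume "x \<in> pverts X"
      then show "\<phi> a x = x" using 7(2)[of "Orig x"] by (simp add: pverts_anchored)
    qed
  next
    case (8 F)
    obtain f where f: "bij_betw f (pverts X) (pverts X)" "\<And>x. x \<in> pverts X \<Longrightarrow> c (f x) = c x"
      "\<And>x y. \<lbrakk>x \<in> pverts X; y \<in> pverts X\<rbrakk> \<Longrightarrow> (x, y) \<in> parcs X \<longleftrightarrow> (f x, f y) \<in> parcs X"
      "\<And>x. x \<in> pverts X \<Longrightarrow> F (Orig x) = Orig (f x) \<and> F (Leaf x) = Leaf (f x)"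
      using automorphism_descends[OF 8(1,3)] by blast
    from complete[OF f(1-3)] obtain a where "a \<in> carrier \<Gamma>" "\<And>x. x \<in> pverts X \<Longrightarrow> f x = \<phi> a x" by blast
    moreover have "F (Anchor i) = Anchor i" if "i < N" for i using Anchor_fixed[OF 8(1,3) that] .
    ultimately show ?case using f(4) by (intro bexI[of _ a]) (auto simp: pverts_anchored)
  qed (auto simp: pverts_anchored group maps mult one)
qed

end


section \<open>A Cayley graph with pinned copies of another one\<close>

text \<open>
  \<open>Arrow s g\<close> stands for the arrow of the Cayley digraph of \<open>\<Gamma>\<close> from \<open>Base g\<close> to \<open>Base (g \<otimes> s)\<close>. The
  primed points form the copies of the Cayley digraph of \<open>\<Delta>\<close>; their first argument is the element
  of \<open>\<Gamma>\<close> that names the copy.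
\<close>

datatype ('a, 'b) point = Base 'a | Arrow 'a 'a | Base' 'a 'b | Arrow' 'a 'b 'b

datatype ('a, 'b) kind = KBase | KArrow 'a | KBase' | KArrow' 'b

fun kind_of :: "('a, 'b) point \<Rightarrow> ('a, 'b) kind" where
  "kind_of (Base g) = KBase"
| "kind_of (Arrow s g) = KArrow s"
| "kind_of (Base' g h) = KBase'"
| "kind_of (Arrow' g s h) = KArrow' s"

lemma kind_eq_simps [simp]:
  "kind_of p = KBase \<longleftrightarrow> (\<exists>g. p = Base g)"
  "kind_of p = KArrow s \<longleftrightarrow> (\<exists>g. p = Arrow s g)"
  "kind_of p = KBase' \<longleftrightarrow> (\<exists>g h. p = Base' g h)"
  "kind_of p = KArrow' t \<longleftrightarrow> (\<exists>g h. p = Arrow' g t h)"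
  by (cases p; auto)+

text \<open>
  An arrow is joined to its target. Its source is encoded by joining all arrows with the same source to
  a clique; the arrow of \<open>\<one>\<close>, whose target is its source, ties that clique to the vertex itself.
  The set \<open>L\<close> says which of the copies are attached.
\<close>

fun link :: "('a, 'm) monoid_scheme \<Rightarrow> ('b, 'n) monoid_scheme \<Rightarrow> 'a set
    \<Rightarrow> ('a, 'b) point \<Rightarrow> ('a, 'b) point \<Rightarrow> bool" where
  "link \<Gamma> \<Delta> L (Arrow s g) (Arrow t g') \<longleftrightarrow> s \<noteq> t \<and> g = g'"
| "link \<Gamma> \<Delta> L (Arrow s g) (Base g') \<longleftrightarrow> g' = g \<otimes>\<^bsub>\<Gamma>\<^esub> s"
| "link \<Gamma> \<Delta> L (Arrow' g s h) (Arrow' g' t h') \<longleftrightarrow> s \<noteq> t \<and> g = g' \<and> h = h'"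
| "link \<Gamma> \<Delta> L (Arrow' g s h) (Base' g' h') \<longleftrightarrow> g' = g \<and> h' = h \<otimes>\<^bsub>\<Delta>\<^esub> s"
| "link \<Gamma> \<Delta> L (Base g) (Base' g' h) \<longleftrightarrow> g \<in> L \<and> g' = g \<and> h = \<one>\<^bsub>\<Delta>\<^esub>"
| "link \<Gamma> \<Delta> L _ _ \<longleftrightarrow> False"

fun on_points :: "('a, 'm) monoid_scheme \<Rightarrow> ('b, 'n) monoid_scheme \<Rightarrow> ('a, 'b) point \<Rightarrow> bool" where
  "on_points \<Gamma> \<Delta> (Base g) \<longleftrightarrow> g \<in> carrier \<Gamma>"
| "on_points \<Gamma> \<Delta> (Arrow s g) \<longleftrightarrow> s \<in> carrier \<Gamma> \<and> g \<in> carrier \<Gamma>"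
| "on_points \<Gamma> \<Delta> (Base' g h) \<longleftrightarrow> g \<in> carrier \<Gamma> \<and> h \<in> carrier \<Delta>"
| "on_points \<Gamma> \<Delta> (Arrow' g s h) \<longleftrightarrow> g \<in> carrier \<Gamma> \<and> s \<in> carrier \<Delta> \<and> h \<in> carrier \<Delta>"

definition linked :: "('a, 'm) monoid_scheme \<Rightarrow> ('b, 'n) monoid_scheme \<Rightarrow> 'a set
    \<Rightarrow> ('a, 'b) point pair_pre_digraph" where
  "linked \<Gamma> \<Delta> L = \<lparr>pverts = Collect (on_points \<Gamma> \<Delta>),
     parcs = {(p, q). on_points \<Gamma> \<Delta> p \<and> on_points \<Gamma> \<Delta> q \<and> (link \<Gamma> \<Delta> L p q \<or> link \<Gamma> \<Delta> L q p)}\<rparr>"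

lemma pverts_linked [simp]: "p \<in> pverts (linked \<Gamma> \<Delta> L) \<longleftrightarrow> on_points \<Gamma> \<Delta> p"
  by (simp add: linked_def)

lemma parcs_linked [simp]: "(p, q) \<in> parcs (linked \<Gamma> \<Delta> L) \<longleftrightarrow>
    on_points \<Gamma> \<Delta> p \<and> on_points \<Gamma> \<Delta> q \<and> (link \<Gamma> \<Delta> L p q \<or> link \<Gamma> \<Delta> L q p)"
  by (simp add: linked_def)

lemma pverts_linked_eq: "pverts (linked \<Gamma> \<Delta> L) = Base ` carrier \<Gamma>
    \<union> case_prod Arrow ` (carrier \<Gamma> \<times> carrier \<Gamma>) \<union> case_prod Base' ` (carrier \<Gamma> \<times> carrier \<Delta>)
    \<union> (\<lambda>(g, s, h). Arrow' g s h) ` (carrier \<Gamma> \<times> carrier \<Delta> \<times> carrier \<Delta>)"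
proof (rule Set.set_eqI)
  fix p :: "('a, 'b) point"
  show "p \<in> pverts (linked \<Gamma> \<Delta> L) \<longleftrightarrow> p \<in> Base ` carrier \<Gamma>
    \<union> case_prod Arrow ` (carrier \<Gamma> \<times> carrier \<Gamma>) \<union> case_prod Base' ` (carrier \<Gamma> \<times> carrier \<Delta>)
    \<union> (\<lambda>(g, s, h). Arrow' g s h) ` (carrier \<Gamma> \<times> carrier \<Delta> \<times> carrier \<Delta>)"
    by (cases p) (auto simp: image_iff)
qed

lemma pair_graph_linked:
  assumes "finite (carrier \<Gamma>)" "finite (carrier \<Delta>)"
  shows "pair_graph (linked \<Gamma> \<Delta> L)"
proof (rule pair_graphI)
  show "finite (pverts (linked \<Gamma> \<Delta> L))" using assms by (simp add: pverts_linked_eq)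
  have "\<not> link \<Gamma> \<Delta> L p p" for p by (cases p) auto
  then show "irrefl (parcs (linked \<Gamma> \<Delta> L))" by (auto simp: irrefl_def)
qed (auto simp: sym_def)


text \<open>
  This describes a colour-preserving automorphism on a single copy: \<open>Arrow s h\<close> goes to the
  arrow \<open>s\<close> starting at \<open>v s h\<close> of the copy \<open>u s h\<close>, and \<open>Base h\<close> to the element \<open>n h\<close> of the copy
  \<open>m h\<close>. By the cliques, the images of arrows depend only on the source, and the arrow of \<open>\<one>\<close> shows
  that \<open>Base h\<close> moves along with them. The arrows leaving \<open>\<one>\<close> reach every element in one step, so
  the image of \<open>\<one>\<close> determines everything.
\<close>

lemma cayley_rigid:
  fixes \<Delta> :: "('b, 'n) monoid_scheme" (structure)
  assumes "group \<Delta>"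
    and closed: "\<And>s h. \<lbrakk>s \<in> carrier \<Delta>; h \<in> carrier \<Delta>\<rbrakk> \<Longrightarrow> v s h \<in> carrier \<Delta>"
    and clique: "\<And>s t h. \<lbrakk>s \<in> carrier \<Delta>; t \<in> carrier \<Delta>; h \<in> carrier \<Delta>; s \<noteq> t\<rbrakk>
      \<Longrightarrow> u s h = u t h \<and> v s h = v t h"
    and step: "\<And>s h. \<lbrakk>s \<in> carrier \<Delta>; h \<in> carrier \<Delta>\<rbrakk>
      \<Longrightarrow> m (h \<otimes> s) = u s h \<and> n (h \<otimes> s) = v s h \<otimes> s"
    and s: "s \<in> carrier \<Delta>" and h: "h \<in> carrier \<Delta>"
  shows "m h = m \<one>" "n h = n \<one> \<otimes> h" "u s h = m \<one>" "v s h = n \<one> \<otimes> h"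
proof -
  interpret group \<Delta> by fact
  have arrow: "u s h = u \<one> h" "v s h = v \<one> h" if "s \<in> carrier \<Delta>" "h \<in> carrier \<Delta>" for s h
    using clique[of s \<one> h] that by auto
  have base: "m h = u \<one> h" "n h = v \<one> h" if "h \<in> carrier \<Delta>" for h
    using step[of \<one> h] that closed by simp_all
  have "m h = u h \<one>" "n h = v h \<one> \<otimes> h" using step[of h \<one>] h by simp_all
  then show m: "m h = m \<one>" and n: "n h = n \<one> \<otimes> h"
    using arrow[of h \<one>] base[of \<one>] h by simp_all
  show "u s h = m \<one>" "v s h = n \<one> \<otimes> h" using m n base[OF h] arrow[OF s h] by simp_all
qed

text \<open>
  The element \<open>a\<close> translates the Cayley graph of \<open>\<Gamma>\<close>, the copy \<open>g\<close> is moved onto the copy \<open>\<alpha> g\<close>, and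
  \<open>\<beta> g\<close> translates it on the way.
\<close>

fun twist :: "('a, 'm) monoid_scheme \<Rightarrow> ('b, 'n) monoid_scheme \<Rightarrow> 'a \<Rightarrow> ('a \<Rightarrow> 'a) \<Rightarrow> ('a \<Rightarrow> 'b)
    \<Rightarrow> ('a, 'b) point \<Rightarrow> ('a, 'b) point" where
  "twist \<Gamma> \<Delta> a \<alpha> \<beta> (Base g) = Base (a \<otimes>\<^bsub>\<Gamma>\<^esub> g)"
| "twist \<Gamma> \<Delta> a \<alpha> \<beta> (Arrow s g) = Arrow s (a \<otimes>\<^bsub>\<Gamma>\<^esub> g)"
| "twist \<Gamma> \<Delta> a \<alpha> \<beta> (Base' g h) = Base' (\<alpha> g) (\<beta> g \<otimes>\<^bsub>\<Delta>\<^esub> h)"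
| "twist \<Gamma> \<Delta> a \<alpha> \<beta> (Arrow' g s h) = Arrow' (\<alpha> g) s (\<beta> g \<otimes>\<^bsub>\<Delta>\<^esub> h)"

text \<open>
  Colours and Cayley edges alone force \<open>f\<close> to be a twist, in which \<open>a\<close>, \<open>\<alpha>\<close> and \<open>\<beta>\<close> are
  independent of each other. Only the link at \<open>g\<close> couples them: its image has to be a link
  again, and links meet copies in \<open>\<one>\<close>.
\<close>

lemma kind_automorphism_shape:
  fixes \<Gamma> :: "('a, 'm) monoid_scheme" and \<Delta> :: "('b, 'n) monoid_scheme"
    and f :: "('a, 'b) point \<Rightarrow> ('a, 'b) point"
  assumes \<Gamma>: "group \<Gamma>" and \<Delta>: "group \<Delta>"
    and V: "\<And>p. on_points \<Gamma> \<Delta> p \<Longrightarrow> on_points \<Gamma> \<Delta> (f p)"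
    and kind: "\<And>p. on_points \<Gamma> \<Delta> p \<Longrightarrow> kind_of (f p) = kind_of p"
    and arcs: "\<And>p q. \<lbrakk>on_points \<Gamma> \<Delta> p; on_points \<Gamma> \<Delta> q; link \<Gamma> \<Delta> L p q\<rbrakk>
      \<Longrightarrow> link \<Gamma> \<Delta> L (f p) (f q) \<or> link \<Gamma> \<Delta> L (f q) (f p)"
  obtains a \<alpha> \<beta> where "a \<in> carrier \<Gamma>"
    "\<And>g. g \<in> carrier \<Gamma> \<Longrightarrow> \<alpha> g \<in> carrier \<Gamma> \<and> \<beta> g \<in> carrier \<Delta>"
    "\<And>p. on_points \<Gamma> \<Delta> p \<Longrightarrow> f p = twist \<Gamma> \<Delta> a \<alpha> \<beta> p"
    "\<And>g. \<lbrakk>g \<in> carrier \<Gamma>; g \<in> L\<rbrakk> \<Longrightarrow> a \<otimes>\<^bsub>\<Gamma>\<^esub> g \<in> L \<and> \<alpha> g = a \<otimes>\<^bsub>\<Gamma>\<^esub> g \<and> \<beta> g = \<one>\<^bsub>\<Delta>\<^esub>"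
proof -
  interpret \<Gamma>: group \<Gamma> by fact
  interpret \<Delta>: group \<Delta> by fact
  have "\<exists>g'. g \<in> carrier \<Gamma> \<longrightarrow> f (Base g) = Base g'" for g using kind[of "Base g"] by auto
  then obtain n where n: "\<And>g. g \<in> carrier \<Gamma> \<Longrightarrow> f (Base g) = Base (n g)" by metis
  have "\<exists>g'. s \<in> carrier \<Gamma> \<and> g \<in> carrier \<Gamma> \<longrightarrow> f (Arrow s g) = Arrow s g'" for s g
    using kind[of "Arrow s g"] by auto
  then obtain v where v: "\<And>s g. \<lbrakk>s \<in> carrier \<Gamma>; g \<in> carrier \<Gamma>\<rbrakk> \<Longrightarrow> f (Arrow s g) = Arrow s (v s g)"
    by metis
  have "\<exists>g' h'. g \<in> carrier \<Gamma> \<and> h \<in> carrier \<Delta> \<longrightarrow> f (Base' g h) = Base' g' h'" for g h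
    using kind[of "Base' g h"] by auto
  then obtain m' n' where n': "\<And>g h. \<lbrakk>g \<in> carrier \<Gamma>; h \<in> carrier \<Delta>\<rbrakk>
      \<Longrightarrow> f (Base' g h) = Base' (m' g h) (n' g h)" by metis
  have "\<exists>g' h'. g \<in> carrier \<Gamma> \<and> s \<in> carrier \<Delta> \<and> h \<in> carrier \<Delta>
      \<longrightarrow> f (Arrow' g s h) = Arrow' g' s h'" for g s h
    using kind[of "Arrow' g s h"] by auto
  then obtain u' v' where v': "\<And>g s h. \<lbrakk>g \<in> carrier \<Gamma>; s \<in> carrier \<Delta>; h \<in> carrier \<Delta>\<rbrakk>
      \<Longrightarrow> f (Arrow' g s h) = Arrow' (u' g s h) s (v' g s h)" by metis
  have v_closed: "v s g \<in> carrier \<Gamma>" if "s \<in> carrier \<Gamma>" "g \<in> carrier \<Gamma>" for s g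
    using V[of "Arrow s g"] v that by simp
  have v'_closed: "v' g s h \<in> carrier \<Delta>" if "g \<in> carrier \<Gamma>" "s \<in> carrier \<Delta>" "h \<in> carrier \<Delta>" for g s h
    using V[of "Arrow' g s h"] v' that by simp
  have n_closed: "n g \<in> carrier \<Gamma>" if "g \<in> carrier \<Gamma>" for g
    using V[of "Base g"] n that by simp
  have n'_closed: "m' g h \<in> carrier \<Gamma>" "n' g h \<in> carrier \<Delta>" if "g \<in> carrier \<Gamma>" "h \<in> carrier \<Delta>" for g h
    using V[of "Base' g h"] n' that by simp_all
  \<comment> \<open>The Cayley graph of \<open>\<Gamma>\<close> itself comes as a single copy, indexed by \<open>()\<close>.\<close>
  have v_clique: "() = () \<and> v s g = v t g"
    if "s \<in> carrier \<Gamma>" "t \<in> carrier \<Gamma>" "g \<in> carrier \<Gamma>" "s \<noteq> t" for s t g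
    using arcs[of "Arrow s g" "Arrow t g"] that v by auto
  have v_step: "() = () \<and> n (g \<otimes>\<^bsub>\<Gamma>\<^esub> s) = v s g \<otimes>\<^bsub>\<Gamma>\<^esub> s" if "s \<in> carrier \<Gamma>" "g \<in> carrier \<Gamma>" for s g
    using arcs[of "Arrow s g" "Base (g \<otimes>\<^bsub>\<Gamma>\<^esub> s)"] that v n by simp
  have v'_clique: "u' g s h = u' g t h \<and> v' g s h = v' g t h"
    if "g \<in> carrier \<Gamma>" "s \<in> carrier \<Delta>" "t \<in> carrier \<Delta>" "h \<in> carrier \<Delta>" "s \<noteq> t" for g s t h
    using arcs[of "Arrow' g s h" "Arrow' g t h"] that v' by auto
  have v'_step: "m' g (h \<otimes>\<^bsub>\<Delta>\<^esub> s) = u' g s h \<and> n' g (h \<otimes>\<^bsub>\<Delta>\<^esub> s) = v' g s h \<otimes>\<^bsub>\<Delta>\<^esub> s"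
    if "g \<in> carrier \<Gamma>" "s \<in> carrier \<Delta>" "h \<in> carrier \<Delta>" for g s h
    using arcs[of "Arrow' g s h" "Base' g (h \<otimes>\<^bsub>\<Delta>\<^esub> s)"] that v' n' by simp
  have rigid: "n g = n \<one>\<^bsub>\<Gamma>\<^esub> \<otimes>\<^bsub>\<Gamma>\<^esub> g" "v s g = n \<one>\<^bsub>\<Gamma>\<^esub> \<otimes>\<^bsub>\<Gamma>\<^esub> g"
    if "s \<in> carrier \<Gamma>" "g \<in> carrier \<Gamma>" for s g
    using cayley_rigid(2,4)[where v = v and n = n and u = "\<lambda>_ _. ()" and m = "\<lambda>_. ()",
        OF \<Gamma> v_closed v_clique v_step that] by blast+
  have rigid': "m' g h = m' g \<one>\<^bsub>\<Delta>\<^esub>" "n' g h = n' g \<one>\<^bsub>\<Delta>\<^esub> \<otimes>\<^bsub>\<Delta>\<^esub> h"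
      "u' g s h = m' g \<one>\<^bsub>\<Delta>\<^esub>" "v' g s h = n' g \<one>\<^bsub>\<Delta>\<^esub> \<otimes>\<^bsub>\<Delta>\<^esub> h"
    if "g \<in> carrier \<Gamma>" "s \<in> carrier \<Delta>" "h \<in> carrier \<Delta>" for g s h
    using cayley_rigid[where v = "v' g" and n = "n' g" and u = "u' g" and m = "m' g",
        OF \<Delta> v'_closed v'_clique v'_step that(2,3)] that(1) by blast+
  show thesis
  proof (rule that[of "n \<one>\<^bsub>\<Gamma>\<^esub>" "\<lambda>g. m' g \<one>\<^bsub>\<Delta>\<^esub>" "\<lambda>g. n' g \<one>\<^bsub>\<Delta>\<^esub>"], goal_cases)
    case (3 p)
    then show ?case
    proof (cases p)
      case (Base g)
      then show ?thesis using 3 n[of g] rigid(1)[of g g] by simp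
    next
      case (Arrow s g)
      then show ?thesis using 3 v[of s g] rigid(2)[of s g] by simp
    next
      case (Base' g h)
      then show ?thesis using 3 n'[of g h] rigid'(1,2)[of g h h] by simp
    next
      case (Arrow' g s h)
      then show ?thesis using 3 v'[of g s h] rigid'(3,4)[of g s h] by simp
    qed
  next
    case (4 g)
    have "n g = n \<one>\<^bsub>\<Gamma>\<^esub> \<otimes>\<^bsub>\<Gamma>\<^esub> g" using rigid(1)[OF \<Gamma>.one_closed 4(1)] .
    then show ?case using arcs[of "Base g" "Base' g \<one>\<^bsub>\<Delta>\<^esub>"] 4 n n' by simp
  qed (use n_closed n'_closed in auto)
qed

text \<open>
  With every copy attached, the links determine \<open>\<alpha>\<close> and \<open>\<beta>\<close> from \<open>a\<close>.
\<close>

lemma exact_action_all_links: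
  fixes \<Gamma> :: "('a, 'm) monoid_scheme" and \<Delta> :: "('b, 'n) monoid_scheme"
  assumes "group \<Gamma>" "group \<Delta>"
  shows "exact_action \<Gamma> (linked \<Gamma> \<Delta> (carrier \<Gamma>)) kind_of (\<lambda>a. twist \<Gamma> \<Delta> a (\<lambda>g. a \<otimes>\<^bsub>\<Gamma>\<^esub> g) (\<lambda>_. \<one>\<^bsub>\<Delta>\<^esub>))"
proof -
  interpret \<Gamma>: group \<Gamma> by fact
  interpret \<Delta>: group \<Delta> by fact
  let ?t = "\<lambda>a. twist \<Gamma> \<Delta> a (\<lambda>g. a \<otimes>\<^bsub>\<Gamma>\<^esub> g) (\<lambda>_. \<one>\<^bsub>\<Delta>\<^esub>)"
  show ?thesis
  proof (rule exact_action.intro, goal_cases)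
    case (2 a p)
    then show ?case by (cases p) auto
  next
    case (3 a p)
    then show ?case by (cases p) auto
  next
    case (4 a p q)
    have "link \<Gamma> \<Delta> (carrier \<Gamma>) (?t a p) (?t a q)"
      if "link \<Gamma> \<Delta> (carrier \<Gamma>) p q" "on_points \<Gamma> \<Delta> p" "on_points \<Gamma> \<Delta> q" for p q
      using that 4(1) by (cases p; cases q) (auto simp: \<Gamma>.m_assoc)
    moreover have "on_points \<Gamma> \<Delta> (?t a p)" if "on_points \<Gamma> \<Delta> p" for p
      using that 4(1) by (cases p) auto
    ultimately show ?case using 4 by auto
  next
    case (5 a b p)
    then show ?case by (cases p) (auto simp: \<Gamma>.m_assoc)
  next
    case (6 p)
    then show ?case by (cases p) auto
  next
    case (7 a)
    then show ?case using 7(2)[of "Base \<one>\<^bsub>\<Gamma>\<^esub>"] by simp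
  next
    case (8 f)
    have V: "on_points \<Gamma> \<Delta> (f p)" if "on_points \<Gamma> \<Delta> p" for p
      using bij_betwE[OF 8(1)] that by simp
    have kind: "kind_of (f p) = kind_of p" if "on_points \<Gamma> \<Delta> p" for p
      using 8(2) that by simp
    have arcs: "link \<Gamma> \<Delta> (carrier \<Gamma>) (f p) (f q) \<or> link \<Gamma> \<Delta> (carrier \<Gamma>) (f q) (f p)"
      if "on_points \<Gamma> \<Delta> p" "on_points \<Gamma> \<Delta> q" "link \<Gamma> \<Delta> (carrier \<Gamma>) p q" for p q
      using 8(3)[of p q] that by simp
    obtain a \<alpha> \<beta> where a: "a \<in> carrier \<Gamma>"
      and closed: "\<And>g. g \<in> carrier \<Gamma> \<Longrightarrow> \<alpha> g \<in> carrier \<Gamma> \<and> \<beta> g \<in> carrier \<Delta>"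
      and f: "\<And>p. on_points \<Gamma> \<Delta> p \<Longrightarrow> f p = twist \<Gamma> \<Delta> a \<alpha> \<beta> p"
      and links: "\<And>g. \<lbrakk>g \<in> carrier \<Gamma>; g \<in> carrier \<Gamma>\<rbrakk>
        \<Longrightarrow> a \<otimes>\<^bsub>\<Gamma>\<^esub> g \<in> carrier \<Gamma> \<and> \<alpha> g = a \<otimes>\<^bsub>\<Gamma>\<^esub> g \<and> \<beta> g = \<one>\<^bsub>\<Delta>\<^esub>"
      using kind_automorphism_shape[OF assms V kind arcs] by blast
    have "f p = ?t a p" if "on_points \<Gamma> \<Delta> p" for p
      using that f links by (cases p) simp_all
    then show ?case using a by auto
  qed (fact assms(1))
qed

text \<open>
  With the link at \<open>\<one>\<close> missing, translation by \<open>a\<close> has to preserve the complement of \<open>\<one>\<close>, so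
  \<open>a = \<one>\<close>; the attached copies are pinned, and what is left free is \<open>\<beta> \<one>\<close>.
\<close>

lemma exact_action_one_link_missing:
  fixes \<Gamma> :: "('a, 'm) monoid_scheme" and \<Delta> :: "('b, 'n) monoid_scheme"
  assumes "group \<Gamma>" "group \<Delta>"
  shows "exact_action \<Delta> (linked \<Gamma> \<Delta> (carrier \<Gamma> - {\<one>\<^bsub>\<Gamma>\<^esub>})) kind_of
    (\<lambda>b. twist \<Gamma> \<Delta> \<one>\<^bsub>\<Gamma>\<^esub> (\<lambda>g. g) (\<lambda>g. if g = \<one>\<^bsub>\<Gamma>\<^esub> then b else \<one>\<^bsub>\<Delta>\<^esub>))"
proof -
  interpret \<Gamma>: group \<Gamma> by fact
  interpret \<Delta>: group \<Delta> by fact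
  let ?L = "carrier \<Gamma> - {\<one>\<^bsub>\<Gamma>\<^esub>}"
  let ?t = "\<lambda>b. twist \<Gamma> \<Delta> \<one>\<^bsub>\<Gamma>\<^esub> (\<lambda>g. g) (\<lambda>g. if g = \<one>\<^bsub>\<Gamma>\<^esub> then b else \<one>\<^bsub>\<Delta>\<^esub>)"
  show ?thesis
  proof (rule exact_action.intro, goal_cases)
    case (2 b p)
    then show ?case by (cases p) auto
  next
    case (3 b p)
    then show ?case by (cases p) auto
  next
    case (4 b p q)
    have "link \<Gamma> \<Delta> ?L (?t b p) (?t b q)"
      if "link \<Gamma> \<Delta> ?L p q" "on_points \<Gamma> \<Delta> p" "on_points \<Gamma> \<Delta> q" for p q
      using that 4(1) by (cases p; cases q) (auto simp: \<Delta>.m_assoc)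
    moreover have "on_points \<Gamma> \<Delta> (?t b p)" if "on_points \<Gamma> \<Delta> p" for p
      using that 4(1) by (cases p) auto
    ultimately show ?case using 4 by auto
  next
    case (5 a b p)
    then show ?case by (cases p) (auto simp: \<Delta>.m_assoc)
  next
    case (6 p)
    then show ?case by (cases p) auto
  next
    case (7 b)
    then show ?case using 7(2)[of "Base' \<one>\<^bsub>\<Gamma>\<^esub> \<one>\<^bsub>\<Delta>\<^esub>"] by simp
  next
    case (8 f)
    have V: "on_points \<Gamma> \<Delta> (f p)" if "on_points \<Gamma> \<Delta> p" for p
      using bij_betwE[OF 8(1)] that by simp
    have kind: "kind_of (f p) = kind_of p" if "on_points \<Gamma> \<Delta> p" for p
      using 8(2) that by simp
    have arcs: "link \<Gamma> \<Delta> ?L (f p) (f q) \<or> link \<Gamma> \<Delta> ?L (f q) (f p)"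
      if "on_points \<Gamma> \<Delta> p" "on_points \<Gamma> \<Delta> q" "link \<Gamma> \<Delta> ?L p q" for p q
      using 8(3)[of p q] that by simp
    obtain a \<alpha> \<beta> where a: "a \<in> carrier \<Gamma>"
      and closed: "\<And>g. g \<in> carrier \<Gamma> \<Longrightarrow> \<alpha> g \<in> carrier \<Gamma> \<and> \<beta> g \<in> carrier \<Delta>"
      and f: "\<And>p. on_points \<Gamma> \<Delta> p \<Longrightarrow> f p = twist \<Gamma> \<Delta> a \<alpha> \<beta> p"
      and links': "\<And>g. \<lbrakk>g \<in> carrier \<Gamma>; g \<in> ?L\<rbrakk>
        \<Longrightarrow> a \<otimes>\<^bsub>\<Gamma>\<^esub> g \<in> ?L \<and> \<alpha> g = a \<otimes>\<^bsub>\<Gamma>\<^esub> g \<and> \<beta> g = \<one>\<^bsub>\<Delta>\<^esub>"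
      using kind_automorphism_shape[OF assms V kind arcs] by blast
    have links: "a \<otimes>\<^bsub>\<Gamma>\<^esub> g \<in> ?L" "\<alpha> g = a \<otimes>\<^bsub>\<Gamma>\<^esub> g" "\<beta> g = \<one>\<^bsub>\<Delta>\<^esub>" if "g \<in> ?L" for g
      using links'[of g] that by blast+
    \<comment> \<open>Otherwise the attached vertex \<open>inv a\<close> would move to the unattached \<open>\<one>\<close>.\<close>
    have a1: "a = \<one>\<^bsub>\<Gamma>\<^esub>"
    proof (rule ccontr)
      assume "a \<noteq> \<one>\<^bsub>\<Gamma>\<^esub>"
      then have "inv\<^bsub>\<Gamma>\<^esub> a \<in> ?L" using a by simp
      then show False using links a by (metis \<Gamma>.r_inv Diff_iff insertI1)
    qed
    \<comment> \<open>The other copies are mapped onto themselves and leave no room for the detached one.\<close>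
    have \<alpha>1: "\<alpha> \<one>\<^bsub>\<Gamma>\<^esub> = \<one>\<^bsub>\<Gamma>\<^esub>"
    proof (rule ccontr)
      let ?g = "\<alpha> \<one>\<^bsub>\<Gamma>\<^esub>"
      assume "?g \<noteq> \<one>\<^bsub>\<Gamma>\<^esub>"
      then have g: "?g \<in> ?L" using closed by simp
      have "f (Base' \<one>\<^bsub>\<Gamma>\<^esub> \<one>\<^bsub>\<Delta>\<^esub>) = f (Base' ?g (\<beta> \<one>\<^bsub>\<Gamma>\<^esub>))"
        using f g links[OF g] closed[of "\<one>\<^bsub>\<Gamma>\<^esub>"] a1 by simp
      moreover have "inj_on f (pverts (linked \<Gamma> \<Delta> ?L))" using 8(1) by (simp add: bij_betw_def)
      ultimately have "Base' \<one>\<^bsub>\<Gamma>\<^esub> \<one>\<^bsub>\<Delta>\<^esub> = Base' ?g (\<beta> \<one>\<^bsub>\<Gamma>\<^esub>)"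
        using closed by (elim inj_onD) simp_all
      then show False using \<open>?g \<noteq> \<one>\<^bsub>\<Gamma>\<^esub>\<close> by simp
    qed
    have "f p = ?t (\<beta> \<one>\<^bsub>\<Gamma>\<^esub>) p" if "on_points \<Gamma> \<Delta> p" for p
      using that f links a1 \<alpha>1 by (cases p) auto
    then show ?case using closed by auto
  qed (fact assms(2))
qed

lemma delete_edge_linked:
  assumes "group \<Gamma>" "group \<Delta>" "g\<^sub>0 \<in> carrier \<Gamma>"
  shows "delete_edge (linked \<Gamma> \<Delta> L) (Base g\<^sub>0) (Base' g\<^sub>0 \<one>\<^bsub>\<Delta>\<^esub>) = linked \<Gamma> \<Delta> (L - {g\<^sub>0})"
proof -
  have "link \<Gamma> \<Delta> (L - {g\<^sub>0}) p q \<longleftrightarrow> link \<Gamma> \<Delta> L p q \<and> (p, q) \<noteq> (Base g\<^sub>0, Base' g\<^sub>0 \<one>\<^bsub>\<Delta>\<^esub>)" for p q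
    by (cases p; cases q) auto
  moreover have "\<not> link \<Gamma> \<Delta> L (Base' g h) (Base g')" for g h g' by simp
  ultimately show ?thesis by (auto simp: delete_edge_def linked_def)
qed

lemma anchoring_linked:
  assumes "group \<Gamma>" "group \<Delta>" "finite (carrier \<Gamma>)" "finite (carrier \<Delta>)"
    and "k ` kind_of ` pverts (linked \<Gamma> \<Delta> L) = {1..<N}"
  shows "anchoring (linked \<Gamma> \<Delta> L) (k \<circ> kind_of) N"
proof -
  interpret \<Gamma>: group \<Gamma> by fact
  interpret \<Delta>: group \<Delta> by fact
  show ?thesis
  proof (rule anchoring.intro)
    show graph: "pair_graph (linked \<Gamma> \<Delta> L)" using assms by (simp add: pair_graph_linked)
    have "{Base \<one>\<^bsub>\<Gamma>\<^esub>, Arrow \<one>\<^bsub>\<Gamma>\<^esub> \<one>\<^bsub>\<Gamma>\<^esub>, Base' \<one>\<^bsub>\<Gamma>\<^esub> \<one>\<^bsub>\<Delta>\<^esub>} \<subseteq> pverts (linked \<Gamma> \<Delta> L)" by auto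
    from card_mono[OF pair_graph_props(1)[OF graph] this]
    show "3 \<le> card (pverts (linked \<Gamma> \<Delta> L))" by simp
    show "\<exists>q \<in> pverts (linked \<Gamma> \<Delta> L). q \<noteq> p \<and> (p, q) \<notin> parcs (linked \<Gamma> \<Delta> L)"
      if "p \<in> pverts (linked \<Gamma> \<Delta> L)" for p
    proof (cases p)
      case (Base g)
      then show ?thesis by (intro bexI[of _ "Arrow' \<one>\<^bsub>\<Gamma>\<^esub> \<one>\<^bsub>\<Delta>\<^esub> \<one>\<^bsub>\<Delta>\<^esub>"]) auto
    next
      case (Arrow s g)
      then show ?thesis by (intro bexI[of _ "Base' \<one>\<^bsub>\<Gamma>\<^esub> \<one>\<^bsub>\<Delta>\<^esub>"]) auto
    next
      case (Base' g h)
      then show ?thesis by (intro bexI[of _ "Arrow \<one>\<^bsub>\<Gamma>\<^esub> \<one>\<^bsub>\<Gamma>\<^esub>"]) auto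
    next
      case (Arrow' g s h)
      then show ?thesis by (intro bexI[of _ "Base \<one>\<^bsub>\<Gamma>\<^esub>"]) auto
    qed
  qed (use assms(5) in \<open>simp add: image_comp\<close>)
qed

theorem theorem4p2:
  fixes \<Gamma>\<^sub>1 :: "('a, 'm) monoid_scheme" and \<Gamma>\<^sub>2 :: "('b, 'n) monoid_scheme"
  assumes "group \<Gamma>\<^sub>1" and "finite (carrier \<Gamma>\<^sub>1)"
    and "group \<Gamma>\<^sub>2" and "finite (carrier \<Gamma>\<^sub>2)"
  shows "\<exists>(G :: nat pair_pre_digraph) u v. pair_graph G \<and> (u, v) \<in> parcs G \<and>
    Aut G \<cong> \<Gamma>\<^sub>1 \<and> Aut (delete_edge G u v) \<cong> \<Gamma>\<^sub>2"
proof -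
  interpret \<Gamma>\<^sub>1: group \<Gamma>\<^sub>1 by fact
  interpret \<Gamma>\<^sub>2: group \<Gamma>\<^sub>2 by fact
  define X where "X = linked \<Gamma>\<^sub>1 \<Gamma>\<^sub>2"
  let ?L = "carrier \<Gamma>\<^sub>1" and ?L' = "carrier \<Gamma>\<^sub>1 - {\<one>\<^bsub>\<Gamma>\<^sub>1\<^esub>}"
  let ?e = "Base \<one>\<^bsub>\<Gamma>\<^sub>1\<^esub>" and ?e' = "Base' \<one>\<^bsub>\<Gamma>\<^sub>1\<^esub> \<one>\<^bsub>\<Gamma>\<^sub>2\<^esub>"
  have graph: "pair_graph (X L)" for L using assms by (simp add: X_def pair_graph_linked)
  \<comment> \<open>Colours, anchors and numbering depend only on the vertex set, so they serve both graphs.\<close>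
  have verts: "pverts (X L) = pverts (X ?L)" for L by (simp add: X_def linked_def)
  define N where "N = Suc (card (kind_of ` pverts (X ?L)))"
  obtain k where "bij_betw k (kind_of ` pverts (X ?L)) {1..<N}"
    using finite_same_card_bij[of "kind_of ` pverts (X ?L)" "{1..<N}"] pair_graph_props(1)[OF graph[of ?L]]
    unfolding N_def by fastforce
  then have k: "inj_on k (kind_of ` pverts (X L))" "k ` kind_of ` pverts (X L) = {1..<N}" for L
    by (simp_all add: verts[of L] bij_betw_def)
  define c where "c = k \<circ> kind_of"
  have anchoring: "anchoring (X L) c N" for L
    unfolding X_def c_def using assms k(2)[of L] by (intro anchoring_linked) (simp_all add: X_def)
  define G where "G L = anchored (X L) c N" for L
  have graph_G: "pair_graph (G L)" for L using pair_graph_anchored[OF graph] by (simp add: G_def)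
  have verts_G: "pverts (G L) = pverts (G ?L)" for L by (simp add: G_def pverts_anchored verts[of L])
  obtain h :: "_ \<Rightarrow> nat" where "inj_on h (pverts (G ?L))"
    using finite_imp_inj_to_nat_seg[OF pair_graph_props(1)[OF graph_G[of ?L]]] by blast
  then have h: "inj_on h (pverts (G L))" for L by (simp add: verts_G[of L])
  have Aut: "Aut (relabel h (G L)) \<cong> \<Gamma>" if "exact_action \<Gamma> (X L) kind_of \<phi>"
    for L and \<Gamma> :: "('c, 'k) monoid_scheme" and \<phi>
  proof -
    have "exact_action \<Gamma> (X L) c \<phi>" using exact_action.recolour[OF that k(1)] by (simp add: c_def)
    then have "exact_action \<Gamma> (G L) (\<lambda>_. ()) (\<lambda>a. map_anchored (\<phi> a))"
      unfolding G_def by (rule anchoring.exact_action_anchored[OF anchoring])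
    from exact_action.Aut_iso[OF exact_action_relabel[OF graph_G h this]] show ?thesis by simp
  qed
  have arc: "(Orig ?e, Orig ?e') \<in> parcs (G ?L)"
    by (simp add: G_def X_def parcs_anchored pverts_anchored)
  have ends: "Orig ?e \<in> pverts (G ?L)" "Orig ?e' \<in> pverts (G ?L)"
    by (simp_all add: G_def X_def pverts_anchored)
  have deleted: "delete_edge (relabel h (G ?L)) (h (Orig ?e)) (h (Orig ?e')) = relabel h (G ?L')"
    using delete_edge_relabel[OF graph_G h ends]
    by (simp add: G_def delete_edge_anchored X_def delete_edge_linked assms)
  show ?thesis
  proof (intro exI conjI)
    show "pair_graph (relabel h (G ?L))" by (rule pair_graph_relabel[OF graph_G h])
    show "(h (Orig ?e), h (Orig ?e')) \<in> parcs (relabel h (G ?L))"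
      using arc relabel_arc[OF graph_G h ends] by blast
    show "Aut (relabel h (G ?L)) \<cong> \<Gamma>\<^sub>1"
      by (rule Aut, unfold X_def, rule exact_action_all_links[OF assms(1,3)])
    show "Aut (delete_edge (relabel h (G ?L)) (h (Orig ?e)) (h (Orig ?e'))) \<cong> \<Gamma>\<^sub>2"
      unfolding deleted by (rule Aut, unfold X_def, rule exact_action_one_link_missing[OF assms(1,3)])
  qed
qed

end
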